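(* Suppose $Y\sim GAL(\mu,\sigma,p,\alpha)$. Then the moment generating function of $Y$, denoted $M_Y(t)$, is $$ M_Y(t)=2p(1-p)\left[\frac{(p_{\alpha_{+}}-p_{\alpha_{-}})}{(p_{\alpha_{-}}-\sigma t)(p_{\alpha_{+}}-\sigma t)}\right]\exp\Big\{\mu t+\tfrac12\alpha^2\sigma^2t^2\Big\}\,\Phi\big(|\alpha|\sigma t\big), $$ where $p_{\alpha_{+}}=p-I(\alpha>0)$ and $p_{\alpha_{-}}=p-I(\alpha<0)$.
   Context: $\Phi$ denotes the standard normal cumulative distribution function, $I(\cdot)$ the indicator function, and $M_Y(t)=E[e^{tY}]$. The generalized asymmetric Laplace distribution $GAL(\mu,\sigma,p,\alpha)$, with location parameter $\mu$, scale parameter $\sigma>0$, $p\in(0,1)$ and shape parameter $\alpha$, is the law of $$Y=\mu+\sigma A W+\sigma\alpha S+\sigma\,[BW]^{1/2}U,$$ where $W,S,U$ are mutually independent, $W$ is exponential with mean $1$, $S$ is half-normal $N^{+}(0,1)$ (density $\frac{2}{\sqrt{2\pi}}e^{-s^2/2}$ on $(0,\infty)$), $U\sim N(0,1)$, $A=\frac{1-2p}{p(1-p)}$ and $B=\frac{2}{p(1-p)}$.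
   Formalization: The printed formula fails for α ≤ 0 (at t=0 it gives −1 if α<0 and 0 if α=0). It is proved for α>0; for α ≤ 0 the bracket is replaced by 1/((p−σt)(1−p+σt)) and Φ(|α|σt) by Φ(ασt). M_Y(t) is taken where it exists, shown to be p−1<σt<p. *)

theory Defs
  imports "HOL-Probability.Probability"
begin

definition half_normal_density :: "real \<Rightarrow> real" where
  "half_normal_density s = (if 0 < s then 2 / sqrt (2 * pi) * exp (- s\<^sup>2 / 2) else 0)"

definition GAL_A :: "real \<Rightarrow> real" where
  "GAL_A p = (1 - 2 * p) / (p * (1 - p))"

definition GAL_B :: "real \<Rightarrow> real" where
  "GAL_B p = 2 / (p * (1 - p))"

text \<open>
  The joint law of \<open>(W, S, U)\<close> is the product of the three marginal laws, which is what
  mutual independence of \<open>W\<close>, \<open>S\<close> and \<open>U\<close> amounts to.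
\<close>

definition GAL :: "real \<Rightarrow> real \<Rightarrow> real \<Rightarrow> real \<Rightarrow> real measure" where
  "GAL \<mu> \<sigma> p \<alpha> =
     distr (density lborel (exponential_density 1) \<Otimes>\<^sub>M
            (density lborel half_normal_density \<Otimes>\<^sub>M std_normal_distribution)) borel
       (\<lambda>(w, s, u). \<mu> + \<sigma> * GAL_A p * w + \<sigma> * \<alpha> * s + \<sigma> * sqrt (GAL_B p * w) * u)"

definition std_normal_cdf :: "real \<Rightarrow> real" where
  "std_normal_cdf = cdf std_normal_distribution"

text \<open>
  The Bochner integral is \<open>0\<close> for non-integrable functions, so \<open>mgf M Y t\<close> is meaningful only
  for those \<open>t\<close> with \<open>mgf_exists M Y t\<close>.
\<close>

definition mgf_exists :: "'a measure \<Rightarrow> ('a \<Rightarrow> real) \<Rightarrow> real \<Rightarrow> bool" where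
  "mgf_exists M Y t \<longleftrightarrow> integrable M (\<lambda>\<omega>. exp (t * Y \<omega>))"

definition mgf :: "'a measure \<Rightarrow> ('a \<Rightarrow> real) \<Rightarrow> real \<Rightarrow> real" where
  "mgf M Y t = (\<integral>\<omega>. exp (t * Y \<omega>) \<partial>M)"

text \<open>
  The closed form of the moment generating function in terms of these two quantities and
  \<open>\<bar>\<alpha>\<bar>\<close> is valid for \<open>\<alpha> > 0\<close> only: at \<open>t = 0\<close>, where every moment generating function is \<open>1\<close>,
  it evaluates to \<open>-1\<close> if \<open>\<alpha> < 0\<close> and to \<open>0\<close> if \<open>\<alpha> = 0\<close>. For \<open>\<alpha> \<le> 0\<close> the correct value comes from
  \<open>1 - GAL_A p * x - GAL_B p * x\<^sup>2 / 2 = (p - x) * (1 - p + x) / (p * (1 - p))\<close> with \<open>x = \<sigma> * t\<close>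
  and from \<open>E[exp (k * S)] = 2 * exp (k\<^sup>2 / 2) * std_normal_cdf k\<close> with \<open>k = \<alpha> * \<sigma> * t\<close>.
\<close>

definition p_alpha_plus :: "real \<Rightarrow> real \<Rightarrow> real" where
  "p_alpha_plus p \<alpha> = p - of_bool (\<alpha> > 0)"

definition p_alpha_minus :: "real \<Rightarrow> real \<Rightarrow> real" where
  "p_alpha_minus p \<alpha> = p - of_bool (\<alpha> < 0)"

end

theory Submission
  imports Defs
begin

text \<open>
  All integrands are positive, so by Tonelli the expectation of \<open>exp (t * Y)\<close> factors, as an
  extended nonnegative real, into three one-dimensional integrals. Put \<open>x = \<sigma> * t\<close> and
  \<open>k = \<alpha> * \<sigma> * t\<close>. Completing the square handles \<open>U\<close> and \<open>S\<close>; what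
  remains is the moment generating function of the exponential law at \<open>q = GAL_A p * x + GAL_B p * x\<^sup>2 / 2\<close>,
  which is finite iff \<open>q < 1\<close>, and \<open>1 - q = (p - x) * (1 - p + x) / (p * (1 - p))\<close>.
\<close>

lemma measurable_half_normal_density[measurable]: "half_normal_density \<in> borel_measurable borel"
  unfolding half_normal_density_def by measurable

text \<open>Tonelli asks only for sigma-finiteness of this factor, which follows from the density
  being finite everywhere.\<close>

lemma sigma_finite_half_normal: "sigma_finite_measure (density lborel half_normal_density)"
  by (subst sigma_finite_measure.sigma_finite_iff_density_finite)
    (auto simp: sigma_finite_lborel)

text \<open>
  The reflection \<open>s \<mapsto> k - s\<close>, rather than the shift \<open>s \<mapsto> s - k\<close>, turns the half-line
  \<open>0 \<le> s\<close> into a lower half-line, whose mass is directly a value of the distribution function.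
\<close>

lemma nn_integral_exp_std_normal_reflect:
  assumes [measurable]: "A \<in> sets borel"
  shows "(\<integral>\<^sup>+s. ennreal (std_normal_density s * exp (k * s)) * indicator A (k - s) \<partial>lborel)
    = ennreal (exp (k\<^sup>2 / 2)) * emeasure std_normal_distribution A"
proof -
  \<comment> \<open>Completing the square: \<open>k * (k - s) - (k - s)\<^sup>2 / 2 = k\<^sup>2 / 2
    - s\<^sup>2 / 2\<close>.\<close>
  have sq: "std_normal_density (k - s) * exp (k * (k - s)) = exp (k\<^sup>2 / 2) * std_normal_density s" for s
    by (simp add: normal_density_def exp_add[symmetric] power2_eq_square field_simps)
  have "(\<integral>\<^sup>+s. ennreal (std_normal_density s * exp (k * s)) * indicator A (k - s) \<partial>lborel)
    = (\<integral>\<^sup>+s. ennreal (exp (k\<^sup>2 / 2)) * (ennreal (std_normal_density s) * indicator A s) \<partial>lborel)"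
    by (subst nn_integral_real_affine[where c = "-1" and t = k])
      (simp_all add: sq ennreal_mult mult.assoc)
  also have "\<dots> = ennreal (exp (k\<^sup>2 / 2)) * emeasure std_normal_distribution A"
    by (simp add: nn_integral_cmult emeasure_density)
  finally show ?thesis .
qed

text \<open>This is the reflection identity for \<open>A = UNIV\<close>, where the indicator is
  constantly 1 and the mass is 1.\<close>

lemma nn_integral_exp_std_normal:
  "(\<integral>\<^sup>+u. ennreal (exp (c * u)) \<partial>std_normal_distribution) = ennreal (exp (c\<^sup>2 / 2))"
proof -
  interpret prob_space std_normal_distribution
    by (rule prob_space_normal_density) simp
  show ?thesis
    using nn_integral_exp_std_normal_reflect[of UNIV c] emeasure_space_1
    by (simp add: nn_integral_density ennreal_mult)
qed

lemma emeasure_std_normal_atMost: "emeasure std_normal_distribution {..k} = ennreal (std_normal_cdf k)"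
proof -
  interpret prob_space std_normal_distribution
    by (rule prob_space_normal_density) simp
  show ?thesis
    by (simp add: std_normal_cdf_def cdf_def emeasure_eq_measure)
qed

text \<open>The normal density vanishes nowhere, so a half-line of mass 0 would be Lebesgue-null,
  yet it contains an interval of length 1. Strictness matters later: in \<open>ennreal\<close>, 0
  times infinity is 0.\<close>

lemma std_normal_cdf_pos: "0 < std_normal_cdf k"
proof (rule ccontr)
  assume "\<not> 0 < std_normal_cdf k"
  then have "emeasure std_normal_distribution {..k} = 0"
    by (simp add: emeasure_std_normal_atMost ennreal_neg)
  then have "AE x in lborel. ennreal (std_normal_density x) * indicator {..k} x = 0"
    by (simp add: emeasure_density nn_integral_0_iff_AE)
  moreover have "std_normal_density x \<noteq> 0" for x
    using normal_density_pos[of 1 0 x] by simp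
  ultimately have "AE x in lborel. x \<notin> {..k}"
    by (auto simp: indicator_def elim!: eventually_mono)
  then have "emeasure lborel {..k} = 0"
    by (subst (asm) AE_iff_measurable[where N = "{..k}"]) auto
  moreover have "emeasure lborel {k - 1..k} \<le> emeasure lborel {..k}"
    by (rule emeasure_mono) auto
  ultimately show False
    by simp
qed

text \<open>The half-normal density is twice the normal one on the positive half-line, and
  \<open>0 \<le> s\<close> means \<open>k - s \<le> k\<close>, so the reflection identity applies
  with \<open>A = {..k}\<close>.\<close>

lemma nn_integral_exp_half_normal:
  "(\<integral>\<^sup>+s. ennreal (exp (k * s)) \<partial>density lborel half_normal_density)
    = ennreal (2 * exp (k\<^sup>2 / 2) * std_normal_cdf k)"
proof -
  have "(\<integral>\<^sup>+s. ennreal (exp (k * s)) \<partial>density lborel half_normal_density)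
    = (\<integral>\<^sup>+s. 2 * (ennreal (std_normal_density s * exp (k * s)) * indicator {..k} (k - s)) \<partial>lborel)"
  proof (subst nn_integral_density, simp, simp, rule nn_integral_cong_AE)
    \<comment> \<open>The two sides differ at \<open>s = 0\<close>, where the half-normal density is
      0 but the indicator is 1.\<close>
    have "ennreal (half_normal_density s) * ennreal (exp (k * s))
      = 2 * (ennreal (std_normal_density s * exp (k * s)) * indicator {..k} (k - s))" if "s \<noteq> 0" for s
    proof (cases "0 < s")
      case True
      then have "half_normal_density s = 2 * std_normal_density s"
        by (simp add: half_normal_density_def normal_density_def)
      then show ?thesis
        using True by (simp add: ennreal_mult mult.assoc)
    qed (use that in \<open>simp add: half_normal_density_def\<close>)
    then show "AE s in lborel. ennreal (half_normal_density s) * ennreal (exp (k * s))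
      = 2 * (ennreal (std_normal_density s * exp (k * s)) * indicator {..k} (k - s))"
      using AE_lborel_singleton[of "0::real"] by (rule eventually_mono[rotated])
  qed
  also have "\<dots> = ennreal (2 * exp (k\<^sup>2 / 2) * std_normal_cdf k)"
  proof -
    have "0 \<le> std_normal_cdf k"
      using std_normal_cdf_pos[of k] by simp
    then have "2 * (ennreal (exp (k\<^sup>2 / 2)) * ennreal (std_normal_cdf k))
        = ennreal (2 * exp (k\<^sup>2 / 2) * std_normal_cdf k)"
      by (metis ennreal_mult' ennreal_numeral exp_ge_zero mult.assoc zero_le_numeral)
    then show ?thesis
      by (subst nn_integral_cmult)
        (simp_all only: nn_integral_exp_std_normal_reflect emeasure_std_normal_atMost sets_lborel
          atMost_borel, measurable)
  qed
  finally show ?thesis .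
qed

text \<open>For \<open>q < 1\<close>, tilting by \<open>exp (q * w)\<close> yields a multiple of the
  exponential density of rate \<open>1 - q\<close>. Otherwise the tilted density is at least 1 on a
  half-line of infinite length.\<close>

lemma nn_integral_exp_exponential:
  "(\<integral>\<^sup>+w. ennreal (exp (q * w)) \<partial>density lborel (exponential_density 1))
    = (if q < 1 then ennreal (1 / (1 - q)) else \<infinity>)"
proof (cases "q < 1")
  case True
  interpret prob_space "density lborel (exponential_density (1 - q))"
    using True by (intro prob_space_exponential_density) simp
  have "exponential_density 1 w * exp (q * w) = 1 / (1 - q) * exponential_density (1 - q) w" for w
    using True by (simp add: exponential_density_def exp_add[symmetric] divide_simps) (simp add: algebra_simps)
  then have "(\<integral>\<^sup>+w. ennreal (exp (q * w)) \<partial>density lborel (exponential_density 1))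
    = (\<integral>\<^sup>+w. ennreal (1 / (1 - q)) * ennreal (exponential_density (1 - q) w) \<partial>lborel)"
    using True
    by (simp add: nn_integral_density ennreal_mult'[symmetric] exponential_density_nonneg
        del: divide_ennreal)
  also have "\<dots> = ennreal (1 / (1 - q)) * emeasure (density lborel (exponential_density (1 - q))) UNIV"
    by (simp add: nn_integral_cmult emeasure_density)
  finally show ?thesis
    using True emeasure_space_1 by simp
next
  case False
  have "(\<integral>\<^sup>+w. indicator {0::real..} w \<partial>lborel) \<le> (\<integral>\<^sup>+w. ennreal (exponential_density 1 w) * ennreal (exp (q * w)) \<partial>lborel)"
  proof (rule nn_integral_mono)
    fix w :: real
    have "1 \<le> exp (- w) * exp (q * w)" if "0 \<le> w"
      using mult_right_mono[of 1 q w] that False by (simp add: exp_add[symmetric])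
    then show "indicator {0..} w \<le> ennreal (exponential_density 1 w) * ennreal (exp (q * w))"
      by (auto simp: indicator_def exponential_density_def ennreal_mult'[symmetric])
  qed
  moreover have "(\<integral>\<^sup>+w. indicator {0::real..} w \<partial>lborel) = \<infinity>"
  proof -
    have "of_nat n \<le> emeasure lborel {0::real..}" for n
      using emeasure_mono[of "{0..real n}" "{0..}" lborel] by (simp add: ennreal_of_nat_eq_real_of_nat)
    then show ?thesis
      unfolding infinity_ennreal_def ennreal_SUP_of_nat_eq_top[symmetric]
      by (intro antisym SUP_least) (simp_all add: ennreal_SUP_of_nat_eq_top)
  qed
  ultimately show ?thesis
    using False by (simp add: nn_integral_density top.extremum_unique)
qed

text \<open>The roots \<open>p\<close> and \<open>p - 1\<close> in \<open>x\<close> become the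
  endpoints of the interval of existence.\<close>

lemma one_minus_GAL_exponent:
  assumes "0 < p" "p < 1"
  shows "1 - (GAL_A p * x + GAL_B p * x\<^sup>2 / 2) = (p - x) * (1 - p + x) / (p * (1 - p))"
  using assms by (simp add: GAL_A_def GAL_B_def power2_eq_square divide_simps) algebra

lemma nn_integral_exp_GAL:
  fixes \<mu> \<sigma> p \<alpha> t :: real
  assumes p: "0 < p" "p < 1"
  defines "x \<equiv> \<sigma> * t" and "k \<equiv> \<alpha> * \<sigma> * t"
  shows "(\<integral>\<^sup>+y. ennreal (exp (t * y)) \<partial>GAL \<mu> \<sigma> p \<alpha>)
    = ennreal (2 * exp (\<mu> * t + k\<^sup>2 / 2) * std_normal_cdf k)
      * (if p - 1 < x \<and> x < p then ennreal (p * (1 - p) / ((p - x) * (1 - p + x))) else \<infinity>)"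
proof -
  let ?E = "density lborel (exponential_density 1)"
  let ?H = "density lborel half_normal_density"
  let ?N = "std_normal_distribution"
  define q where "q = GAL_A p * x + GAL_B p * x\<^sup>2 / 2"
  define C where "C = 2 * exp (\<mu> * t + k\<^sup>2 / 2) * std_normal_cdf k"
  define f where "f = (\<lambda>(w, s, u). \<mu> + \<sigma> * GAL_A p * w + \<sigma> * \<alpha> * s + \<sigma> * sqrt (GAL_B p * w) * u)"
  interpret N: prob_space ?N
    by (rule prob_space_normal_density) simp
  interpret H: sigma_finite_measure ?H
    by (rule sigma_finite_half_normal)
  interpret HN: sigma_finite_measure "?H \<Otimes>\<^sub>M ?N"
    by (rule sigma_finite_pair_measure) unfold_locales
  have f[measurable]: "f \<in> borel_measurable (?E \<Otimes>\<^sub>M (?H \<Otimes>\<^sub>M ?N))"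
    unfolding f_def by measurable
  have inner: "(\<integral>\<^sup>+su. ennreal (exp (t * f (w, su))) \<partial>(?H \<Otimes>\<^sub>M ?N)) = ennreal C * ennreal (exp (q * w))"
    if "0 \<le> w" for w
  proof -
    \<comment> \<open>With \<open>w\<close> fixed, \<open>c\<close> is the coefficient of
      \<open>u\<close> in the exponent. Its square is linear in \<open>w\<close>, so integrating out
      \<open>u\<close> leaves an exponential in \<open>w\<close>.\<close>
    define c where "c = x * sqrt (GAL_B p * w)"
    have "0 \<le> GAL_B p * w"
      using p that by (simp add: GAL_B_def)
    then have c2: "c\<^sup>2 = x\<^sup>2 * (GAL_B p * w)"
      by (simp add: c_def power_mult_distrib)
    have split: "exp (t * f (w, s, u)) = exp (\<mu> * t + GAL_A p * x * w) * exp (k * s) * exp (c * u)" for s u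
      by (simp add: f_def c_def k_def x_def exp_add[symmetric] algebra_simps)
    have "(\<integral>\<^sup>+su. ennreal (exp (t * f (w, su))) \<partial>(?H \<Otimes>\<^sub>M ?N))
      = (\<integral>\<^sup>+s. \<integral>\<^sup>+u. ennreal (exp (t * f (w, s, u))) \<partial>?N \<partial>?H)"
      using measurable_Pair2[OF f, of w] by (intro N.nn_integral_fst[symmetric]) simp
    also have "\<dots> = ennreal (exp (\<mu> * t + GAL_A p * x * w)) * ennreal (2 * exp (k\<^sup>2 / 2) * std_normal_cdf k)
        * ennreal (exp (c\<^sup>2 / 2))"
      unfolding split nn_integral_exp_std_normal[symmetric] nn_integral_exp_half_normal[symmetric]
      by (simp add: ennreal_mult' nn_integral_cmult nn_integral_multc)
    also have "\<dots> = ennreal (C * exp (q * w))"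
      using std_normal_cdf_pos[of k]
      by (simp add: ennreal_mult'[symmetric] C_def q_def c2 exp_add[symmetric] field_simps)
    finally show ?thesis
      using std_normal_cdf_pos[of k] by (simp add: C_def ennreal_mult)
  qed
  have "(\<integral>\<^sup>+y. ennreal (exp (t * y)) \<partial>GAL \<mu> \<sigma> p \<alpha>)
    = (\<integral>\<^sup>+z. ennreal (exp (t * f z)) \<partial>(?E \<Otimes>\<^sub>M (?H \<Otimes>\<^sub>M ?N)))"
    unfolding GAL_def f_def[symmetric] by (rule nn_integral_distr) simp_all
  also have "\<dots> = (\<integral>\<^sup>+w. \<integral>\<^sup>+su. ennreal (exp (t * f (w, su))) \<partial>(?H \<Otimes>\<^sub>M ?N) \<partial>?E)"
    by (intro HN.nn_integral_fst[symmetric]) measurable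
  also have "\<dots> = (\<integral>\<^sup>+w. ennreal C * ennreal (exp (q * w)) \<partial>?E)"
    \<comment> \<open>The exponential density vanishes for negative \<open>w\<close>, so
      \<open>inner\<close> is needed only for \<open>0 \<le> w\<close>.\<close>
    by (rule nn_integral_cong_AE) (auto simp: AE_density exponential_density_def inner)
  also have "\<dots> = ennreal C * (if q < 1 then ennreal (1 / (1 - q)) else \<infinity>)"
    by (simp add: nn_integral_cmult nn_integral_exp_exponential)
  also have "1 - q = (p - x) * (1 - p + x) / (p * (1 - p))"
    unfolding q_def by (rule one_minus_GAL_exponent) fact+
  also have "q < 1 \<longleftrightarrow> p - 1 < x \<and> x < p"
  proof -
    have "q < 1 \<longleftrightarrow> 0 < (p - x) * (1 - p + x)"
      using one_minus_GAL_exponent[OF p, of x] p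
      by (metis diff_gt_0_iff_gt mult_pos_pos q_def zero_less_divide_iff not_less_iff_gr_or_eq)
    \<comment> \<open>Both factors cannot be negative: that would force \<open>p < x\<close> and
      \<open>x < p - 1\<close>.\<close>
    also have "\<dots> \<longleftrightarrow> p - 1 < x \<and> x < p"
      by (auto simp: zero_less_mult_iff)
    finally show ?thesis .
  qed
  finally show ?thesis
    by (simp add: C_def)
qed

theorem theorem3:
  fixes M :: "'a measure" and Y :: "'a \<Rightarrow> real" and \<mu> \<sigma> p \<alpha> t :: real
  assumes "prob_space M"
    and "Y \<in> borel_measurable M"
    and "0 < \<sigma>" and "0 < p" and "p < 1"
    and "distr M borel Y = GAL \<mu> \<sigma> p \<alpha>"
  shows "(mgf_exists M Y t \<longleftrightarrow> p - 1 < \<sigma> * t \<and> \<sigma> * t < p) \<and>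
    (mgf_exists M Y t \<longrightarrow>
      (\<alpha> > 0 \<longrightarrow>
        mgf M Y t =
          2 * p * (1 - p)
          * ((p_alpha_plus p \<alpha> - p_alpha_minus p \<alpha>) /
             ((p_alpha_minus p \<alpha> - \<sigma> * t) * (p_alpha_plus p \<alpha> - \<sigma> * t)))
          * exp (\<mu> * t + 1 / 2 * \<alpha>\<^sup>2 * \<sigma>\<^sup>2 * t\<^sup>2)
          * std_normal_cdf (\<bar>\<alpha>\<bar> * \<sigma> * t)) \<and>
      (\<alpha> \<le> 0 \<longrightarrow>
        mgf M Y t =
          2 * p * (1 - p)
          * (1 / ((p - \<sigma> * t) * (1 - p + \<sigma> * t)))
          * exp (\<mu> * t + 1 / 2 * \<alpha>\<^sup>2 * \<sigma>\<^sup>2 * t\<^sup>2)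
          * std_normal_cdf (\<alpha> * \<sigma> * t)))"
proof -
  note [measurable] = \<open>Y \<in> borel_measurable M\<close>
  define x k where "x = \<sigma> * t" and "k = \<alpha> * \<sigma> * t"
  define C where "C = 2 * exp (\<mu> * t + k\<^sup>2 / 2) * std_normal_cdf k"
  define R where "R = p * (1 - p) / ((p - x) * (1 - p + x))"
  have C: "0 < C"
    by (simp add: C_def std_normal_cdf_pos)
  have "(\<integral>\<^sup>+\<omega>. ennreal (exp (t * Y \<omega>)) \<partial>M) = (\<integral>\<^sup>+y. ennreal (exp (t * y)) \<partial>distr M borel Y)"
    by (simp add: nn_integral_distr)
  then have nn: "(\<integral>\<^sup>+\<omega>. ennreal (exp (t * Y \<omega>)) \<partial>M)
      = ennreal C * (if p - 1 < x \<and> x < p then ennreal R else \<infinity>)"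
    using nn_integral_exp_GAL[OF \<open>0 < p\<close> \<open>p < 1\<close>] assms(6)
    by (simp add: C_def R_def x_def k_def)
  \<comment> \<open>Integrability is finiteness of \<open>nn\<close>; outside the interval
    \<open>C > 0\<close> keeps the product with infinity infinite.\<close>
  have ex: "mgf_exists M Y t \<longleftrightarrow> p - 1 < x \<and> x < p"
    using C by (auto simp: mgf_exists_def integrable_iff_bounded nn ennreal_mult_less_top ennreal_mult_top)
  have val: "mgf M Y t = C * R" if "p - 1 < x" "x < p"
  proof -
    \<comment> \<open>\<open>ennreal\<close> truncates negative reals to 0, so \<open>R\<close> can
      be recovered from it only if nonnegative.\<close>
    have "0 \<le> R"
      using that \<open>0 < p\<close> \<open>p < 1\<close> by (simp add: R_def)
    then show ?thesis
      using C that by (simp add: mgf_def integral_eq_nn_integral nn ennreal_mult[symmetric])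
  qed
  have CR: "C * R = 2 * p * (1 - p) * (1 / ((p - x) * (1 - p + x)))
      * exp (\<mu> * t + 1 / 2 * \<alpha>\<^sup>2 * \<sigma>\<^sup>2 * t\<^sup>2) * std_normal_cdf k"
    by (simp add: C_def R_def k_def power_mult_distrib)
  \<comment> \<open>For \<open>\<alpha> > 0\<close> the numerator is \<open>-1\<close>, and its sign
    cancels against that of the factor \<open>p - 1 - x\<close>. For \<open>\<alpha> \<le> 0\<close>
    the claim is \<open>CR\<close> itself.\<close>
  have "(p_alpha_plus p \<alpha> - p_alpha_minus p \<alpha>) / ((p_alpha_minus p \<alpha> - x) * (p_alpha_plus p \<alpha> - x))
      = 1 / ((p - x) * (1 - p + x))" if "\<alpha> > 0"
  proof -
    have "(p - x) * (p - 1 - x) = - ((p - x) * (1 - p + x))"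
      by (simp add: algebra_simps)
    then show ?thesis
      using that by (simp add: p_alpha_plus_def p_alpha_minus_def)
  qed
  then show ?thesis
    using ex val CR by (simp add: x_def k_def)
qed

end
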